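(* Let $\mathcal{N}=(\mathcal{V},\mathcal{E},s,t)$ be a network in which each link has unit capacity when not in outage, and links are in outage independently, each with probability $p$. Let $\mathcal{L}$ be the collection of all minimal cut-sets, let $m$ be the minimum size of a cut-set, and let $C$ be the instantaneous capacity. Suppose that the minimal cut-sets $\mathcal{C}\in\mathcal{L}$ are pairwise disjoint. For integers $i\ge 0$ and $\mathcal{C}\in\mathcal{L}$ put $$q(i,|\mathcal{C}|,p)=\sum_{j\ge i}\binom{|\mathcal{C}|}{j}p^{|\mathcal{C}|-j}(1-p)^{j}.$$ Then for every $i\in\{0,1,\dots,m\}$ the probability $C_i(p)=\Pr[C=i]$ is $$C_i(p)=\prod_{\mathcal{C}\in\mathcal{L}}q(i,|\mathcal{C}|,p)-\prod_{\mathcal{C}\in\mathcal{L}}q(i+1,|\mathcal{C}|,p),$$ and the ergodic network capacity is $E[C](p)=\sum_{i=0}^{m} i\,C_i(p)$.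
   Context: A network $\mathcal{N}=(\mathcal{V},\mathcal{E},s,t)$ is a directed acyclic graph with finite vertex set $\mathcal{V}$, a finite multi-set $\mathcal{E}$ of directed edges (links; parallel edges allowed, regarded as distinct edges), a source vertex $s$ and a terminal vertex $t$, with $s\neq t$. A cut-set is a subset $\mathcal{C}\subseteq\mathcal{E}$ whose removal from the network leaves no directed path from $s$ to $t$. A cut-set is minimal if no proper subset of it is a cut-set. At a given time instant each link is randomly in outage or not. The instantaneous ($s$-$t$ unicast) capacity $C$ is the random variable equal to the size of a minimum $s$-$t$-separating cut (smallest set of edges whose removal leaves no directed path from $s$ to $t$) in the subgraph of $\mathcal{N}$ consisting of the links that are not in outage. The ergodic network capacity is the expected value of $C$. An empty sum is $0$, $\binom{a}{j}=0$ for $j>a$, and $0^0=1$. *)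

theory Defs
  imports "HOL-Probability.Probability" "Graph_Theory.Arc_Walk"
begin

locale network = fin_digraph G for G :: "('v, 'e) pre_digraph" (structure) +
  fixes s t :: 'v
  assumes source_in_verts: "s \<in> verts G"
    and terminal_in_verts: "t \<in> verts G"
    and source_neq_terminal: "s \<noteq> t"
    and acyclic: "\<not> (\<exists>c. cycle c)"

definition delete_arcs :: "('v, 'e) pre_digraph \<Rightarrow> 'e set \<Rightarrow> ('v, 'e) pre_digraph" where
  "delete_arcs G F = G\<lparr>arcs := arcs G - F\<rparr>"

definition cut_set :: "('v, 'e) pre_digraph \<Rightarrow> 'v \<Rightarrow> 'v \<Rightarrow> 'e set \<Rightarrow> bool" where
  "cut_set G s t F \<longleftrightarrow> F \<subseteq> arcs G \<and> \<not> (\<exists>\<pi>. pre_digraph.apath (delete_arcs G F) s \<pi> t)"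

definition minimal_cut_sets :: "('v, 'e) pre_digraph \<Rightarrow> 'v \<Rightarrow> 'v \<Rightarrow> 'e set set" where
  "minimal_cut_sets G s t = {F. cut_set G s t F \<and> (\<forall>F'. F' \<subset> F \<longrightarrow> \<not> cut_set G s t F')}"

text \<open>For finite G and distinct s, t the set of all arcs is a cut-set, so this is the minimum
  of a finite nonempty set.\<close>

definition min_cut_size :: "('v, 'e) pre_digraph \<Rightarrow> 'v \<Rightarrow> 'v \<Rightarrow> nat" where
  "min_cut_size G s t = Min (card ` {F. cut_set G s t F})"

text \<open>\<open>Out e\<close> is the event that link \<open>e\<close> is in outage.\<close>

definition instantaneous_capacity ::
    "('v, 'e) pre_digraph \<Rightarrow> 'v \<Rightarrow> 'v \<Rightarrow> ('e \<Rightarrow> 'w set) \<Rightarrow> 'w \<Rightarrow> nat" where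
  "instantaneous_capacity G s t Out \<omega> =
     min_cut_size (delete_arcs G {e \<in> arcs G. \<omega> \<in> Out e}) s t"

text \<open>The sum over all \<open>j \<ge> i\<close> may stop at \<open>n\<close>, since \<open>n choose j = 0\<close> for \<open>j > n\<close>.\<close>

definition binomial_tail :: "nat \<Rightarrow> nat \<Rightarrow> real \<Rightarrow> real" where
  "binomial_tail i n p = (\<Sum>j=i..n. real (n choose j) * p ^ (n - j) * (1 - p) ^ j)"

end

(* Menger's theorem is not needed: a set F is a cut-set of the network without the failed
   links Z iff F \<union> Z is a cut-set of G, so the capacity is the minimum of card (F - Z) over the
   minimal cut-sets F of G. Hence "capacity \<ge> i" is the intersection over the minimal cut-sets of
   the events "at least i links of F are working". Pairwise disjointness makes these events
   independent, and each has a binomial tail probability. *)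

theory Submission
  imports Defs
begin

section \<open>Paths and cut-sets under deletion of arcs\<close>

lemma delete_arcs_empty [simp]: "delete_arcs G {} = G"
  by (simp add: delete_arcs_def)

lemma delete_arcs_delete_arcs: "delete_arcs (delete_arcs G A) B = delete_arcs G (A \<union> B)"
  by (simp add: delete_arcs_def Diff_eq Int_assoc)

lemma verts_delete_arcs [simp]: "verts (delete_arcs G A) = verts G"
  and arcs_delete_arcs [simp]: "arcs (delete_arcs G A) = arcs G - A"
  and tail_delete_arcs [simp]: "tail (delete_arcs G A) = tail G"
  and head_delete_arcs [simp]: "head (delete_arcs G A) = head G"
  by (simp_all add: delete_arcs_def)

lemma awalk_verts_delete_arcs:
  "pre_digraph.awalk_verts (delete_arcs G A) u \<pi> = pre_digraph.awalk_verts G u \<pi>"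
  by (induction \<pi> arbitrary: u) (simp_all add: pre_digraph.awalk_verts.simps)

lemma cas_delete_arcs:
  "pre_digraph.cas (delete_arcs G A) u \<pi> v = pre_digraph.cas G u \<pi> v"
  by (induction \<pi> arbitrary: u) (simp_all add: pre_digraph.cas.simps)

text \<open>Deletion keeps vertices, tails and heads, so the vertex sequence and the chaining of an
  arc list do not change; only the condition that its arcs belong to the graph becomes stricter.
  Facts about cut-sets thereby reduce to set reasoning about the paths of the one graph
  \<open>G\<close>.\<close>

lemma apath_delete_arcs_iff:
  "pre_digraph.apath (delete_arcs G A) u \<pi> v \<longleftrightarrow> pre_digraph.apath G u \<pi> v \<and> set \<pi> \<inter> A = {}"
  by (auto simp: pre_digraph.apath_def pre_digraph.awalk_def awalk_verts_delete_arcs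
      cas_delete_arcs)

lemma cut_set_mono: "cut_set G s t F \<Longrightarrow> F \<subseteq> F' \<Longrightarrow> F' \<subseteq> arcs G \<Longrightarrow> cut_set G s t F'"
  unfolding cut_set_def apath_delete_arcs_iff by blast

lemma cut_set_delete_arcs_iff:
  assumes "Z \<subseteq> arcs G"
  shows "cut_set (delete_arcs G Z) s t F \<longleftrightarrow> F \<subseteq> arcs G - Z \<and> cut_set G s t (F \<union> Z)"
  using assms by (auto simp: cut_set_def delete_arcs_delete_arcs Un_commute)

text \<open>Strict inclusion is well-founded below a finite set: a cut-set that is not minimal has a
  strictly smaller one inside, to which the induction applies.\<close>

lemma cut_set_imp_minimal:
  assumes "finite F" "cut_set G s t F"
  obtains F' where "F' \<in> minimal_cut_sets G s t" "F' \<subseteq> F"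
proof -
  from assms have "\<exists>F' \<in> minimal_cut_sets G s t. F' \<subseteq> F"
  proof (induction F rule: finite_psubset_induct)
    case (psubset F)
    show ?case
    proof (cases "F \<in> minimal_cut_sets G s t")
      case False
      with psubset.prems obtain E where E: "E \<subset> F" "cut_set G s t E"
        unfolding minimal_cut_sets_def by blast
      then obtain F' where "F' \<in> minimal_cut_sets G s t" "F' \<subseteq> E"
        using psubset.IH[OF E] by auto
      with E(1) show ?thesis by (intro bexI[of _ F']) auto
    qed blast
  qed
  with that show thesis by blast
qed

lemma minimal_cut_setsD:
  assumes "F \<in> minimal_cut_sets G s t"
  shows "cut_set G s t F" "F \<subseteq> arcs G"
  using assms by (auto simp: minimal_cut_sets_def cut_set_def)

text \<open>Without arcs only the empty walk remains, and it would force \<open>s = t\<close>. This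
  makes the family under \<open>Min\<close> in \<open>min_cut_size\<close> nonempty.\<close>

lemma cut_set_arcs: "s \<noteq> t \<Longrightarrow> cut_set G s t (arcs G)"
  by (auto simp: cut_set_def pre_digraph.apath_def pre_digraph.awalk_def pre_digraph.cas.simps)

section \<open>Lower bounds on the capacity in terms of minimal cut-sets\<close>

lemma le_min_cut_size_iff:
  assumes "finite (arcs G)" "s \<noteq> t"
  shows "i \<le> min_cut_size G s t \<longleftrightarrow> (\<forall>F. cut_set G s t F \<longrightarrow> i \<le> card F)"
proof -
  have "finite {F. cut_set G s t F}"
    by (rule finite_subset[OF _ finite_Pow_iff[THEN iffD2, OF assms(1)]]) (auto simp: cut_set_def)
  moreover have "{F. cut_set G s t F} \<noteq> {}"
    using cut_set_arcs[OF assms(2)] by blast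
  ultimately show ?thesis
    unfolding min_cut_size_def by (subst Min_ge_iff) auto
qed

text \<open>Cut-sets of the reduced graph and minimal cut-sets of \<open>G\<close> bound each other:
  \<open>F - Z\<close> cuts the reduced graph whenever \<open>F\<close> cuts \<open>G\<close>, and a
  cut-set \<open>F\<close> of the reduced graph includes \<open>E - Z\<close> for some minimal
  cut-set \<open>E\<close> of \<open>G\<close>. The form with \<open>i \<le>\<close> turns a minimum
  into a conjunction, which later becomes an intersection of events.\<close>

lemma le_min_cut_size_delete_arcs_iff:
  assumes "finite (arcs G)" "s \<noteq> t" "Z \<subseteq> arcs G"
  shows "i \<le> min_cut_size (delete_arcs G Z) s t \<longleftrightarrow>
           (\<forall>F \<in> minimal_cut_sets G s t. i \<le> card (F - Z))"
proof -
  have "i \<le> min_cut_size (delete_arcs G Z) s t \<longleftrightarrow>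
          (\<forall>F. F \<subseteq> arcs G - Z \<and> cut_set G s t (F \<union> Z) \<longrightarrow> i \<le> card F)"
    using assms by (simp add: le_min_cut_size_iff cut_set_delete_arcs_iff)
  also have "\<dots> \<longleftrightarrow> (\<forall>F \<in> minimal_cut_sets G s t. i \<le> card (F - Z))"
  proof (intro iffI ballI allI impI)
    fix F
    assume cuts: "\<forall>F. F \<subseteq> arcs G - Z \<and> cut_set G s t (F \<union> Z) \<longrightarrow> i \<le> card F"
      and F: "F \<in> minimal_cut_sets G s t"
    have "cut_set G s t ((F - Z) \<union> Z)"
      by (rule cut_set_mono[OF minimal_cut_setsD(1)[OF F]])
        (use minimal_cut_setsD(2)[OF F] assms(3) in auto)
    moreover have "F - Z \<subseteq> arcs G - Z"
      using minimal_cut_setsD(2)[OF F] by (rule Diff_mono) simp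
    ultimately show "i \<le> card (F - Z)"
      using cuts[rule_format, of "F - Z"] by simp
  next
    fix F
    assume min: "\<forall>F \<in> minimal_cut_sets G s t. i \<le> card (F - Z)"
      and F: "F \<subseteq> arcs G - Z \<and> cut_set G s t (F \<union> Z)"
    have fin: "finite F" "finite Z"
      using F assms by (auto intro: finite_subset)
    \<comment> \<open>\<open>F \<union> Z\<close> cuts \<open>G\<close> but need not be minimal;
      shrinking it to \<open>E\<close> can only lower the count outside \<open>Z\<close>.\<close>
    then obtain E where E: "E \<in> minimal_cut_sets G s t" "E \<subseteq> F \<union> Z"
      using F cut_set_imp_minimal[of "F \<union> Z" G s t] by auto
    have "i \<le> card (E - Z)" using min E(1) by blast
    also have "\<dots> \<le> card F" using E(2) fin(1) by (intro card_mono) auto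
    finally show "i \<le> card F" .
  qed
  finally show ?thesis .
qed

section \<open>Independent outages and binomial tails\<close>

context prob_space
begin

text \<open>A family with a single event is closed under intersection, so independence extends to
  the generated sigma-algebras. This gives access to the complements, that is, to working
  links.\<close>

lemma indep_sets_sigma_sets_events:
  assumes "indep_events A I"
  shows "indep_sets (\<lambda>e. sigma_sets (space M) {A e}) I"
  by (rule indep_sets_sigma) (use assms in \<open>auto simp: indep_events_def_alt Int_stable_def\<close>)

lemma prob_exact_pattern:
  assumes "indep_events A I" "F \<subseteq> I" "finite F" "S \<subseteq> F" "\<And>e. e \<in> F \<Longrightarrow> prob (A e) = p"
  shows "prob {\<omega> \<in> space M. {e \<in> F. \<omega> \<notin> A e} = S} = p ^ (card F - card S) * (1 - p) ^ card S"
\<comment> \<open>The empty intersection is \<open>UNIV\<close>, not \<open>space M\<close>, and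
  \<open>indep_setsD\<close> asks for a nonempty index set, so this case is separate.\<close>
proof (cases "F = {}")
  case True
  with assms(4) show ?thesis by (simp add: prob_space)
next
  case False
  \<comment> \<open>Reading \<open>A e\<close> as the outage of \<open>e\<close>, the event
    \<open>B e\<close> fixes the state of one link: working for \<open>e \<in> S\<close>, failed
    otherwise. The pattern \<open>S\<close> is the intersection of these independent events.\<close>
  define B where "B e = (if e \<in> S then space M - A e else A e)" for e
  have ev: "A e \<in> events" if "e \<in> F" for e
    using that assms(1,2) by (auto simp: indep_events_def)
  have B: "\<omega> \<in> B e \<longleftrightarrow> \<omega> \<in> space M \<and> (\<omega> \<notin> A e \<longleftrightarrow> e \<in> S)" if "e \<in> F" for \<omega> e
    using sets.sets_into_space[OF ev[OF that]] by (auto simp: B_def)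
  have "{\<omega> \<in> space M. {e \<in> F. \<omega> \<notin> A e} = S} = (\<Inter>e\<in>F. B e)"
  proof (rule set_eqI)
    fix \<omega>
    have "{e \<in> F. \<omega> \<notin> A e} = S \<longleftrightarrow> (\<forall>e\<in>F. \<omega> \<notin> A e \<longleftrightarrow> e \<in> S)"
      using assms(4) by blast
    then show "\<omega> \<in> {\<omega> \<in> space M. {e \<in> F. \<omega> \<notin> A e} = S} \<longleftrightarrow> \<omega> \<in> (\<Inter>e\<in>F. B e)"
      using False by (simp add: B) blast
  qed
  also have "prob \<dots> = (\<Prod>e\<in>F. prob (B e))"
  proof (rule indep_setsD[OF indep_sets_sigma_sets_events[OF assms(1)] assms(2) False assms(3)])
    show "\<forall>e\<in>F. B e \<in> sigma_sets (space M) {A e}"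
      by (auto simp: B_def intro: sigma_sets.intros)
  qed
  also have "\<dots> = (\<Prod>e\<in>F. if e \<in> S then 1 - p else p)"
    by (intro prod.cong) (auto simp: B_def prob_compl ev assms(5))
  also have "\<dots> = (\<Prod>e\<in>F \<inter> S. 1 - p) * (\<Prod>e\<in>F - S. p)"
    using assms(3) by (subst prod.If_cases) (auto simp: Diff_eq)
  also have "F \<inter> S = S" using assms(4) by blast
  also have "(\<Prod>e\<in>S. 1 - p) * (\<Prod>e\<in>F - S. p) = p ^ (card F - card S) * (1 - p) ^ card S"
    using assms(3,4) finite_subset[OF assms(4,3)] by (simp add: card_Diff_subset mult.commute)
  finally show ?thesis .
qed

text \<open>\<open>F\<close> has finitely many subsets, so any property \<open>P\<close> of the set
  of working links is a finite union of finite intersections of the events and their complements.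
  The generator is written as a union of singletons to match the sigma-algebras in
  \<open>indep_sets_collect_sigma\<close>.\<close>

lemma count_event_in_sigma_sets:
  assumes "finite F" "\<And>e. e \<in> F \<Longrightarrow> A e \<subseteq> space M"
  shows "{\<omega> \<in> space M. P {e \<in> F. \<omega> \<notin> A e}} \<in> sigma_sets (space M) (\<Union>e\<in>F. {A e})"
proof -
  interpret S: sigma_algebra "space M" "sigma_sets (space M) (\<Union>e\<in>F. {A e})"
    by (rule sigma_algebra_sigma_sets) (use assms(2) in auto)
  have A: "{\<omega> \<in> space M. \<omega> \<notin> A e} \<in> sigma_sets (space M) (\<Union>e\<in>F. {A e})" if "e \<in> F" for e
  proof -
    have "space M - A e \<in> sigma_sets (space M) (\<Union>e\<in>F. {A e})"
      using that by (intro sigma_sets.Compl sigma_sets.Basic) auto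
    then show ?thesis by (simp add: set_diff_eq)
  qed
  \<comment> \<open>The right-hand side has quantifiers over finite sets only, as the closure rules
    for finite unions and intersections require.\<close>
  have "{\<omega> \<in> space M. P {e \<in> F. \<omega> \<notin> A e}} =
          {\<omega> \<in> space M. \<exists>S\<in>{S \<in> Pow F. P S}. \<forall>e\<in>F. (\<omega> \<notin> A e) = (e \<in> S)}"
  proof (rule Collect_cong, rule conj_cong[OF refl])
    fix \<omega>
    have "(\<forall>e\<in>F. (\<omega> \<notin> A e) = (e \<in> S)) \<longleftrightarrow> {e \<in> F. \<omega> \<notin> A e} = S" if "S \<subseteq> F" for S
      using that by blast
    then have "(\<exists>S\<in>{S \<in> Pow F. P S}. \<forall>e\<in>F. (\<omega> \<notin> A e) = (e \<in> S)) \<longleftrightarrow>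
        (\<exists>S\<in>{S \<in> Pow F. P S}. {e \<in> F. \<omega> \<notin> A e} = S)"
      by (intro bex_cong refl) blast
    also have "\<dots> \<longleftrightarrow> P {e \<in> F. \<omega> \<notin> A e}" by blast
    finally show "P {e \<in> F. \<omega> \<notin> A e} \<longleftrightarrow>
        (\<exists>S\<in>{S \<in> Pow F. P S}. \<forall>e\<in>F. (\<omega> \<notin> A e) = (e \<in> S))" ..
  qed
  also have "\<dots> \<in> sigma_sets (space M) (\<Union>e\<in>F. {A e})"
  proof (intro S.sets_Collect_finite_Ex S.sets_Collect_finite_All)
    fix S e assume "e \<in> F"
    from A[OF this] show "{\<omega> \<in> space M. (\<omega> \<notin> A e) = (e \<in> S)} \<in>
        sigma_sets (space M) (\<Union>e\<in>F. {A e})"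
      using S.sets_Collect_neg[OF A[OF \<open>e \<in> F\<close>]] by (cases "e \<in> S") simp_all
  qed (use assms(1) in auto)
  finally show ?thesis .
qed

text \<open>The event is split by the exact set \<open>S\<close> of working links. Grouping these
  sets by size \<open>j\<close> gives \<open>card F choose j\<close> equal terms each.\<close>

lemma prob_binomial_tail:
  assumes "indep_events A I" "F \<subseteq> I" "finite F" "\<And>e. e \<in> F \<Longrightarrow> prob (A e) = p"
  shows "prob {\<omega> \<in> space M. i \<le> card {e \<in> F. \<omega> \<notin> A e}} = binomial_tail i (card F) p"
proof -
  let ?E = "\<lambda>S. {\<omega> \<in> space M. {e \<in> F. \<omega> \<notin> A e} = S}"
  let ?T = "{S. S \<subseteq> F \<and> i \<le> card S}"
  have ev: "A e \<in> events" if "e \<in> F" for e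
    using that assms(1,2) by (auto simp: indep_events_def)
  have E: "?E S \<in> events" for S
  proof -
    have "?E S \<in> sigma_sets (space M) (\<Union>e\<in>F. {A e})"
      by (rule count_event_in_sigma_sets) (use assms(3) sets.sets_into_space[OF ev] in auto)
    also have "\<dots> \<subseteq> events" by (rule sets.sigma_sets_subset) (use ev in auto)
    finally show ?thesis .
  qed
  have fin: "finite ?T" using assms(3) by simp
  have "{\<omega> \<in> space M. i \<le> card {e \<in> F. \<omega> \<notin> A e}} = (\<Union>S\<in>?T. ?E S)" by auto
  also have "prob \<dots> = (\<Sum>S\<in>?T. prob (?E S))"
    by (rule finite_measure_finite_Union[OF fin]) (use E in \<open>auto simp: disjoint_family_on_def\<close>)
  also have "\<dots> = (\<Sum>S\<in>?T. p ^ (card F - card S) * (1 - p) ^ card S)"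
    by (intro sum.cong prob_exact_pattern[OF assms(1-3)]) (use assms(4) in auto)
  also have "\<dots> = (\<Sum>j=i..card F. \<Sum>S\<in>{S \<in> ?T. card S = j}.
                    p ^ (card F - card S) * (1 - p) ^ card S)"
    by (rule sum.group[symmetric]) (use fin assms(3) in \<open>auto intro: card_mono\<close>)
  also have "\<dots> = (\<Sum>j=i..card F. real (card F choose j) * p ^ (card F - j) * (1 - p) ^ j)"
  proof (intro sum.cong refl)
    fix j assume "j \<in> {i..card F}"
    then have eq: "{S \<in> ?T. card S = j} = {S. S \<subseteq> F \<and> card S = j}" by auto
    show "(\<Sum>S\<in>{S \<in> ?T. card S = j}. p ^ (card F - card S) * (1 - p) ^ card S) =
            real (card F choose j) * p ^ (card F - j) * (1 - p) ^ j"
      unfolding eq by (simp add: n_subsets[OF assms(3)])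
  qed
  finally show ?thesis by (simp add: binomial_tail_def)
qed

text \<open>Disjoint blocks of independent events generate independent sigma-algebras, and the count
  for a block lies in the sigma-algebra of that block, so the probabilities multiply.\<close>

lemma prob_all_binomial_tail:
  assumes "indep_events A I" "finite I" "\<And>e. e \<in> I \<Longrightarrow> prob (A e) = p"
    and "disjoint L" "\<And>F. F \<in> L \<Longrightarrow> F \<subseteq> I"
  shows "{\<omega> \<in> space M. \<forall>F\<in>L. i \<le> card {e \<in> F. \<omega> \<notin> A e}} \<in> events"
    and "prob {\<omega> \<in> space M. \<forall>F\<in>L. i \<le> card {e \<in> F. \<omega> \<notin> A e}} =
           (\<Prod>F\<in>L. binomial_tail i (card F) p)"
proof -
  let ?B = "\<lambda>F. {\<omega> \<in> space M. i \<le> card {e \<in> F. \<omega> \<notin> A e}}"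
  have ev: "A e \<in> events" if "e \<in> I" for e
    using that assms(1) by (auto simp: indep_events_def)
  have fin: "finite F" if "F \<in> L" for F
    using finite_subset[OF assms(5)[OF that] assms(2)] .
  have finL: "finite L"
    by (rule finite_subset[OF _ finite_Pow_iff[THEN iffD2, OF assms(2)]]) (use assms(5) in auto)
  have B: "?B F \<in> sigma_sets (space M) (\<Union>e\<in>F. {A e})" if "F \<in> L" for F
    by (rule count_event_in_sigma_sets[where P = "\<lambda>S. i \<le> card S"])
      (use fin[OF that] sets.sets_into_space[OF ev] assms(5)[OF that] in auto)
  have "indep_sets (\<lambda>e. {A e}) (\<Union>F\<in>L. F)"
    by (rule indep_sets_mono_index[of _ I])
      (use assms(1,5) in \<open>auto simp: indep_events_def_alt\<close>)
  then have indep: "indep_sets (\<lambda>F. sigma_sets (space M) (\<Union>e\<in>F. {A e})) L"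
    by (rule indep_sets_collect_sigma)
      (use assms(4) in \<open>auto simp: Int_stable_def disjoint_family_on_def disjoint_def\<close>)
  \<comment> \<open>Measurability comes for free: \<open>indep_sets\<close> includes that each of
    its families consists of events.\<close>
  have Bev: "?B F \<in> events" if "F \<in> L" for F
    using B[OF that] indep that by (auto simp: indep_sets_def)
  have "{\<omega> \<in> space M. \<forall>F\<in>L. i \<le> card {e \<in> F. \<omega> \<notin> A e}} \<in> events \<and>
    prob {\<omega> \<in> space M. \<forall>F\<in>L. i \<le> card {e \<in> F. \<omega> \<notin> A e}} =
           (\<Prod>F\<in>L. binomial_tail i (card F) p)"
  proof (cases "L = {}")
    case True
    then show ?thesis by (simp add: prob_space)
  next
    case False
    then have eq: "{\<omega> \<in> space M. \<forall>F\<in>L. i \<le> card {e \<in> F. \<omega> \<notin> A e}} = (\<Inter>F\<in>L. ?B F)"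
      by auto
    have "prob (\<Inter>F\<in>L. ?B F) = (\<Prod>F\<in>L. prob (?B F))"
      by (rule indep_setsD[OF indep _ False finL]) (use B in auto)
    also have "\<dots> = (\<Prod>F\<in>L. binomial_tail i (card F) p)"
      by (intro prod.cong refl prob_binomial_tail[OF assms(1)]) (use assms(3,5) fin in blast)+
    finally show ?thesis
      unfolding eq using sets.finite_INT[OF finL False Bev] by simp
  qed
  then show "{\<omega> \<in> space M. \<forall>F\<in>L. i \<le> card {e \<in> F. \<omega> \<notin> A e}} \<in> events"
    and "prob {\<omega> \<in> space M. \<forall>F\<in>L. i \<le> card {e \<in> F. \<omega> \<notin> A e}} =
           (\<Prod>F\<in>L. binomial_tail i (card F) p)"
    by blast+
qed

text \<open>On the space, \<open>X\<close> equals the sum of \<open>i\<close> times the indicator of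
  its level set at \<open>i\<close>; the bound \<open>m\<close> makes this sum finite, so linearity
  suffices.\<close>

lemma expectation_bounded_nat:
  fixes X :: "'a \<Rightarrow> nat"
  assumes "\<And>i. {\<omega> \<in> space M. X \<omega> = i} \<in> events"
    and "\<And>\<omega>. \<omega> \<in> space M \<Longrightarrow> X \<omega> \<le> m"
  shows "expectation (\<lambda>\<omega>. real (X \<omega>)) = (\<Sum>i=0..m. real i * prob {\<omega> \<in> space M. X \<omega> = i})"
proof -
  have "expectation (\<lambda>\<omega>. real (X \<omega>)) =
      expectation (\<lambda>\<omega>. \<Sum>i=0..m. real i * indicator {\<omega> \<in> space M. X \<omega> = i} \<omega>)"
  proof (rule Bochner_Integration.integral_cong[OF refl])
    fix \<omega> assume \<omega>: "\<omega> \<in> space M"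
    then have "(\<Sum>i=0..m. real i * indicator {\<omega> \<in> space M. X \<omega> = i} \<omega>) =
        (\<Sum>i=0..m. if i = X \<omega> then real i else 0)"
      by (intro sum.cong) (auto simp: indicator_def)
    also have "\<dots> = real (X \<omega>)" using assms(2)[OF \<omega>] by simp
    finally show "real (X \<omega>) = (\<Sum>i=0..m. real i * indicator {\<omega> \<in> space M. X \<omega> = i} \<omega>)" ..
  qed
  also have "\<dots> = (\<Sum>i=0..m. real i * prob {\<omega> \<in> space M. X \<omega> = i})"
    using assms(1) by (subst Bochner_Integration.integral_sum)
      (auto simp: emeasure_eq_measure intro!: sum.cong)
  finally show ?thesis .
qed

end

section \<open>Distribution and expectation of the capacity\<close>

theorem mainTheorem2:
  fixes G :: "('v, 'e) pre_digraph" and s t :: 'v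
    and M :: "'w measure" and Out :: "'e \<Rightarrow> 'w set" and p :: real
  assumes "network G s t"
    and "prob_space M"
    and "prob_space.indep_events M Out (arcs G)"
    and "\<And>e. e \<in> arcs G \<Longrightarrow> measure M (Out e) = p"
    and "disjoint (minimal_cut_sets G s t)"
  shows "(\<forall>i \<le> min_cut_size G s t.
            \<P>(\<omega> in M. instantaneous_capacity G s t Out \<omega> = i) =
              (\<Prod>F \<in> minimal_cut_sets G s t. binomial_tail i (card F) p)
              - (\<Prod>F \<in> minimal_cut_sets G s t. binomial_tail (i + 1) (card F) p))
       \<and> prob_space.expectation M (\<lambda>\<omega>. real (instantaneous_capacity G s t Out \<omega>)) =
           (\<Sum>i = 0..min_cut_size G s t.
              real i * \<P>(\<omega> in M. instantaneous_capacity G s t Out \<omega> = i))"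
proof -
  interpret network G s t by fact
  interpret prob_space M by fact
  let ?L = "minimal_cut_sets G s t"
  let ?C = "instantaneous_capacity G s t Out"
  let ?Q = "\<lambda>i. \<Prod>F \<in> ?L. binomial_tail i (card F) p"
  have ge_iff: "i \<le> ?C \<omega> \<longleftrightarrow> (\<forall>F\<in>?L. i \<le> card {e \<in> F. \<omega> \<notin> Out e})" for i \<omega>
  proof -
    have "F - {e \<in> arcs G. \<omega> \<in> Out e} = {e \<in> F. \<omega> \<notin> Out e}" if "F \<in> ?L" for F
      using minimal_cut_setsD(2)[OF that] by blast
    then show ?thesis
      unfolding instantaneous_capacity_def
      by (subst le_min_cut_size_delete_arcs_iff) (auto simp: source_neq_terminal)
  qed
  have ev: "{\<omega> \<in> space M. i \<le> ?C \<omega>} \<in> events" and pr: "\<P>(\<omega> in M. i \<le> ?C \<omega>) = ?Q i" for i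
    unfolding ge_iff
    by (rule prob_all_binomial_tail[OF assms(3) finite_arcs assms(4,5)];
        simp add: minimal_cut_setsD(2))+
  \<comment> \<open>As a difference of nested tail events, the level set is measurable and its
    probability is a difference of two products.\<close>
  have eq: "{\<omega> \<in> space M. ?C \<omega> = i} = {\<omega> \<in> space M. i \<le> ?C \<omega>} - {\<omega> \<in> space M. i + 1 \<le> ?C \<omega>}"
    for i by auto
  \<comment> \<open>Outages cannot raise the capacity, so the expectation sum may stop at the
    minimum cut size.\<close>
  have C_le: "?C \<omega> \<le> min_cut_size G s t" for \<omega>
  proof -
    have "?C \<omega> \<le> card F" if "F \<in> ?L" for F
    proof -
      have "?C \<omega> \<le> card {e \<in> F. \<omega> \<notin> Out e}" using ge_iff that by blast
      also have "\<dots> \<le> card F"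
        using finite_subset[OF minimal_cut_setsD(2)[OF that]] by (intro card_mono) auto
      finally show ?thesis .
    qed
    \<comment> \<open>With no arcs deleted, the earlier criterion says that a lower bound for all
      minimal cut-sets of \<open>G\<close> is one for \<open>min_cut_size G s t\<close>; it is used
      with \<open>?C \<omega>\<close> as the bound.\<close>
    then show ?thesis
      using le_min_cut_size_delete_arcs_iff[of G s t "{}"] source_neq_terminal by simp
  qed
  have "\<P>(\<omega> in M. ?C \<omega> = i) = ?Q i - ?Q (i + 1)" for i
    unfolding eq pr[symmetric] by (rule finite_measure_Diff[OF ev ev]) auto
  moreover have "expectation (\<lambda>\<omega>. real (?C \<omega>)) =
      (\<Sum>i=0..min_cut_size G s t. real i * \<P>(\<omega> in M. ?C \<omega> = i))"
    by (rule expectation_bounded_nat) (use ev C_le in \<open>auto simp: eq\<close>)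
  ultimately show ?thesis by blast
qed

end
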